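(* Let $p\geq3$ be a prime and let $A\in\mathbb{Z}_p$ be written as $A=\sum_{i=0}^{\infty}a_ip^i=\sum_{j=0}^{\infty}b_jp^j$ with $a_i\in\{0,\pm1,\ldots,\pm\frac{p-1}{2}\}$ and $b_j\in\{0,1,\ldots,p-1\}$. Then for every $t\geq0$, $$b_t\equiv a_t+f_t(a_0,\ldots,a_{t-1})\pmod p,\qquad a_t\equiv b_t+g_t(b_0,\ldots,b_{t-1})\pmod p.$$
   Context: Define $$f_t(x_0,\ldots,x_{t-1})=\sum_{\lambda=0}^{t-1}\Bigl\{\sum_{c=1}^{\frac{p-1}{2}}\bigl[(x_\lambda+c)^{p-1}-1\bigr]\Bigr\}\prod_{\lambda<i<t}(1-x_i^{p-1}),$$ $$g_t(y_0,\ldots,y_{t-1})=\sum_{\lambda=0}^{t-1}\Bigl\{\sum_{c=\frac{p+1}{2}}^{p-1}\bigl[1-(y_\lambda-c)^{p-1}\bigr]\Bigr\}\prod_{\lambda<i<t}\Bigl[1-\bigl(y_i-\tfrac{p-1}{2}\bigr)^{p-1}\Bigr],$$ with the conventions that an empty product is $1$ and an empty sum is $0$ (so $f_0=g_0=0$). *)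

theory Defs
  imports "HOL-Analysis.Analysis" "HOL-Algebra.Ring" "HOL-Number_Theory.Cong"
begin

text \<open>
  The ring of p-adic integers as the inverse limit of the rings of integers modulo \<open>p ^ n\<close>:
  the \<open>n\<close>-th component of an element is its residue modulo \<open>p ^ n\<close>, represented in \<open>{0..<p ^ n}\<close>.
\<close>

definition padic_int :: "nat \<Rightarrow> (nat \<Rightarrow> int) ring" where
  "padic_int p =
    \<lparr>carrier = {x. \<forall>n. x n \<in> {0..<int p ^ n} \<and> x (Suc n) mod int p ^ n = x n},
     monoid.mult = (\<lambda>x y n. (x n * y n) mod int p ^ n),
     one = (\<lambda>n. 1 mod int p ^ n),
     zero = (\<lambda>n. 0),
     add = (\<lambda>x y n. (x n + y n) mod int p ^ n)\<rparr>"

text \<open>The p-adic topology, i.e. the inverse limit of the discrete topologies.\<close>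

definition padic_topology :: "nat \<Rightarrow> (nat \<Rightarrow> int) topology" where
  "padic_topology p =
    subtopology (product_topology (\<lambda>n. discrete_topology {0..<int p ^ n}) UNIV)
      (carrier (padic_int p))"

definition padic_sums :: "nat \<Rightarrow> (nat \<Rightarrow> nat \<Rightarrow> int) \<Rightarrow> (nat \<Rightarrow> int) \<Rightarrow> bool" where
  "padic_sums p u A \<longleftrightarrow>
    limitin (padic_topology p) (\<lambda>N. finsum (padic_int p) u {..<N}) A sequentially"

text \<open>\<open>A = d\<^sub>0 + d\<^sub>1 p + d\<^sub>2 p\<^sup>2 + \<dots>\<close>; an integer \<open>k\<close> is seen in the ring as \<open>k\<close> times its unit.\<close>

definition padic_expansion :: "nat \<Rightarrow> (nat \<Rightarrow> int) \<Rightarrow> (nat \<Rightarrow> int) \<Rightarrow> bool" where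
  "padic_expansion p d A \<longleftrightarrow>
    padic_sums p
      (\<lambda>i. ([d i] \<cdot>\<^bsub>padic_int p\<^esub> \<one>\<^bsub>padic_int p\<^esub>) \<otimes>\<^bsub>padic_int p\<^esub>
           (([int p] \<cdot>\<^bsub>padic_int p\<^esub> \<one>\<^bsub>padic_int p\<^esub>) [^]\<^bsub>padic_int p\<^esub> i)) A"

text \<open>The functions \<open>f\<^sub>t\<close> and \<open>g\<^sub>t\<close>; only the arguments \<open>x 0, \<dots>, x (t - 1)\<close> occur.\<close>

definition f_corr :: "nat \<Rightarrow> nat \<Rightarrow> (nat \<Rightarrow> int) \<Rightarrow> int" where
  "f_corr p t x =
    (\<Sum>l<t. (\<Sum>c = 1..(p - 1) div 2. (x l + int c) ^ (p - 1) - 1) *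
            (\<Prod>i\<in>{l<..<t}. 1 - x i ^ (p - 1)))"

definition g_corr :: "nat \<Rightarrow> nat \<Rightarrow> (nat \<Rightarrow> int) \<Rightarrow> int" where
  "g_corr p t y =
    (\<Sum>l<t. (\<Sum>c = (p + 1) div 2..p - 1. 1 - (y l - int c) ^ (p - 1)) *
            (\<Prod>i\<in>{l<..<t}. 1 - (y i - int ((p - 1) div 2)) ^ (p - 1)))"

lemma padic_int_cring:
  assumes "p > 0"
  shows "cring (padic_int p)"
proof -
  have pw: "int p ^ n > 0" for n using assms by simp
  have dv: "(a mod int p ^ Suc n) mod int p ^ n = a mod int p ^ n" for a :: int and n
    by (rule mod_mod_cancel) simp
  have one: "\<one>\<^bsub>padic_int p\<^esub> \<in> carrier (padic_int p)"
    using pw dv by (simp add: padic_int_def)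
  have cl: "(\<lambda>n. F (x n) (y n) mod int p ^ n) \<in> carrier (padic_int p)"
    if "x \<in> carrier (padic_int p)" "y \<in> carrier (padic_int p)"
      and F: "\<And>a b m. F (a mod m) (b mod m) mod m = F a b mod m"
    for x y and F :: "int \<Rightarrow> int \<Rightarrow> int"
  proof -
    have "F (x (Suc n)) (y (Suc n)) mod int p ^ n = F (x n) (y n) mod int p ^ n" for n
      using that(1,2) F[of "x (Suc n)" "int p ^ n" "y (Suc n)"] by (simp add: padic_int_def)
    then show ?thesis using pw dv by (simp add: padic_int_def)
  qed
  have md: "x n mod int p ^ n = x n" if "x \<in> carrier (padic_int p)" for x n
    using that by (simp add: padic_int_def)
  show ?thesis
  proof (intro cringI abelian_groupI comm_monoidI)
    fix x assume x: "x \<in> carrier (padic_int p)"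
    show "\<exists>y\<in>carrier (padic_int p). y \<oplus>\<^bsub>padic_int p\<^esub> x = \<zero>\<^bsub>padic_int p\<^esub>"
    proof (rule bexI)
      show "(\<lambda>n. (0 - x n) mod int p ^ n) \<in> carrier (padic_int p)"
        by (rule cl[of "\<lambda>n. 0" x "\<lambda>a b. a - b"])
           (use x pw in \<open>simp_all add: mod_diff_eq padic_int_def\<close>)
      show "(\<lambda>n. (0 - x n) mod int p ^ n) \<oplus>\<^bsub>padic_int p\<^esub> x = \<zero>\<^bsub>padic_int p\<^esub>"
        by (simp add: padic_int_def mod_add_left_eq)
    qed
  next
    fix x y assume "x \<in> carrier (padic_int p)" "y \<in> carrier (padic_int p)"
    then show "x \<oplus>\<^bsub>padic_int p\<^esub> y \<in> carrier (padic_int p)"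
      using cl[of x y "(+)"] by (simp add: padic_int_def mod_add_eq)
  next
    fix x y assume "x \<in> carrier (padic_int p)" "y \<in> carrier (padic_int p)"
    then show "x \<otimes>\<^bsub>padic_int p\<^esub> y \<in> carrier (padic_int p)"
      using cl[of x y "(*)"] by (simp add: padic_int_def mod_mult_eq)
  qed (use one pw md in \<open>auto simp: padic_int_def fun_eq_iff mod_simps algebra_simps\<close>)
qed

end

theory Submission
  imports Defs "HOL-Number_Theory.Residues"
begin

text \<open>
  Both truncations \<open>\<Sum>i<t. a i * p ^ i\<close> and \<open>\<Sum>i<t. b i * p ^ i\<close> are congruent to \<open>A\<close> modulo
  \<open>p ^ t\<close>, so they differ by \<open>p ^ t * e t\<close> for a carry \<open>e t\<close> with \<open>p * e (t + 1) = e t + b t - a t\<close>.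
  Size bounds force \<open>e t \<in> {0, 1}\<close> and determine \<open>e (t + 1)\<close> from \<open>e t\<close> and either one of the digits
  \<open>a t\<close>, \<open>b t\<close>. By Fermat's little theorem, \<open>1 - z ^ (p - 1)\<close> is the indicator of \<open>p dvd z\<close>
  modulo \<open>p\<close>, whence \<open>- f\<^sub>t\<close> and \<open>g\<^sub>t\<close> satisfy the same recursions as the carry.
\<close>

section \<open>Partial sums and limits in the inverse limit\<close>

lemma padic_int_nat_multiple_of_one:
  assumes "p > 0"
  shows "[(k::nat)] \<cdot>\<^bsub>padic_int p\<^esub> \<one>\<^bsub>padic_int p\<^esub> = (\<lambda>n. int k mod int p ^ n)"
proof -
  interpret cring "padic_int p" using assms by (rule padic_int_cring)
  show ?thesis
  proof (induction k)
    case 0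
    show ?case by (simp add: padic_int_def add_pow_def)
  next
    case (Suc k)
    have "[Suc k] \<cdot>\<^bsub>padic_int p\<^esub> \<one>\<^bsub>padic_int p\<^esub>
        = ([k] \<cdot>\<^bsub>padic_int p\<^esub> \<one>\<^bsub>padic_int p\<^esub>) \<oplus>\<^bsub>padic_int p\<^esub> \<one>\<^bsub>padic_int p\<^esub>"
      by (simp add: add.nat_pow_Suc)
    also have "\<dots> = (\<lambda>n. int (Suc k) mod int p ^ n)"
      unfolding Suc by (simp add: padic_int_def mod_simps add.commute)
    finally show ?case .
  qed
qed

lemma padic_int_int_multiple_of_one:
  assumes "p > 0"
  shows "[(k::int)] \<cdot>\<^bsub>padic_int p\<^esub> \<one>\<^bsub>padic_int p\<^esub> = (\<lambda>n. k mod int p ^ n)"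
proof -
  interpret cring "padic_int p" using assms by (rule padic_int_cring)
  show ?thesis
  proof (cases "k \<ge> 0")
    case True
    then obtain m where "k = int m" using nonneg_int_cases by blast
    then show ?thesis
      using padic_int_nat_multiple_of_one[OF assms, of m] by (simp add: add_pow_int_ge)
  next
    case False
    then have k: "k < 0" "int (nat (- k)) = - k" by auto
    have eq: "[nat (- k)] \<cdot>\<^bsub>padic_int p\<^esub> \<one>\<^bsub>padic_int p\<^esub> = (\<lambda>n. (- k) mod int p ^ n)"
      using padic_int_nat_multiple_of_one[OF assms, of "nat (- k)"] k(2) by simp
    \<comment> \<open>A multiple by a negative integer unfolds to the additive inverse of a natural
      multiple, so uniqueness of inverses identifies it.\<close>
    have "\<ominus>\<^bsub>padic_int p\<^esub> ([nat (- k)] \<cdot>\<^bsub>padic_int p\<^esub> \<one>\<^bsub>padic_int p\<^esub>) = (\<lambda>n. k mod int p ^ n)"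
    proof (rule minus_equality)
      show "(\<lambda>n. k mod int p ^ n) \<oplus>\<^bsub>padic_int p\<^esub> ([nat (- k)] \<cdot>\<^bsub>padic_int p\<^esub> \<one>\<^bsub>padic_int p\<^esub>)
          = \<zero>\<^bsub>padic_int p\<^esub>"
        unfolding eq by (simp add: padic_int_def mod_simps)
      show "(\<lambda>n. k mod int p ^ n) \<in> carrier (padic_int p)"
        using assms by (auto simp: padic_int_def mod_mod_cancel)
    qed simp
    then show ?thesis using k(1) by (simp add: add_pow_int_lt)
  qed
qed

text \<open>All ring operations act componentwise and reduce modulo \<open>p ^ n\<close>, so partial
  sums become residues of ordinary integer sums.\<close>

lemma padic_int_partial_sum:
  assumes "p > 0"
  shows "(\<Oplus>\<^bsub>padic_int p\<^esub>i\<in>{..<N}. ([d i] \<cdot>\<^bsub>padic_int p\<^esub> \<one>\<^bsub>padic_int p\<^esub>) \<otimes>\<^bsub>padic_int p\<^esub>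
           (([int p] \<cdot>\<^bsub>padic_int p\<^esub> \<one>\<^bsub>padic_int p\<^esub>) [^]\<^bsub>padic_int p\<^esub> (i::nat)))
         = (\<lambda>n. (\<Sum>i<N. d i * int p ^ i) mod int p ^ n)"
    (is "finsum _ ?u _ = _")
proof -
  interpret cring "padic_int p" using assms by (rule padic_int_cring)
  have pow: "([int p] \<cdot>\<^bsub>padic_int p\<^esub> \<one>\<^bsub>padic_int p\<^esub>) [^]\<^bsub>padic_int p\<^esub> i
      = (\<lambda>n. int p ^ i mod int p ^ n)" for i :: nat
  proof (induction i)
    case 0
    show ?case by (simp add: padic_int_def)
  next
    case (Suc i)
    show ?case
      unfolding nat_pow_Suc Suc unfolding padic_int_int_multiple_of_one[OF assms]
      by (simp add: padic_int_def mod_simps mult.commute)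
  qed
  have u: "?u i = (\<lambda>n. (d i * int p ^ i) mod int p ^ n)" for i
    unfolding pow unfolding padic_int_int_multiple_of_one[OF assms]
    by (simp add: padic_int_def mod_simps)
  have closed: "?u \<in> {..<N} \<rightarrow> carrier (padic_int p)" for N
    by auto
  show ?thesis
  proof (induction N)
    case 0
    have "finsum (padic_int p) ?u {..<0} = \<zero>\<^bsub>padic_int p\<^esub>" by simp
    then show ?case by (simp add: padic_int_def)
  next
    case (Suc N)
    have "finsum (padic_int p) ?u {..<Suc N} = ?u N \<oplus>\<^bsub>padic_int p\<^esub> finsum (padic_int p) ?u {..<N}"
      unfolding lessThan_Suc by (rule finsum_insert) (use closed in auto)
    also have "\<dots> = (\<lambda>n. (\<Sum>i<Suc N. d i * int p ^ i) mod int p ^ n)"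
      unfolding Suc unfolding u by (simp add: padic_int_def mod_simps add.commute)
    finally show ?case .
  qed
qed

text \<open>Convergence means that every component is eventually constant. Terms with index at least
  \<open>n\<close> vanish modulo \<open>p ^ n\<close>, so component \<open>n\<close> has its final
  value from the \<open>n\<close>-th partial sum on.\<close>

lemma padic_expansion_truncation:
  assumes "p > 0" and "padic_expansion p d A"
  shows "A n = (\<Sum>i<n. d i * int p ^ i) mod int p ^ n"
proof -
  have "limitin (product_topology (\<lambda>n. discrete_topology {0..<int p ^ n}) UNIV)
      (\<lambda>N n. (\<Sum>i<N. d i * int p ^ i) mod int p ^ n) A sequentially"
    using assms(2) unfolding padic_expansion_def padic_sums_def padic_topology_def
      padic_int_partial_sum[OF assms(1)]
    by (simp add: limitin_subtopology)
  then have "limitin (discrete_topology {0..<int p ^ n})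
      (\<lambda>N. (\<Sum>i<N. d i * int p ^ i) mod int p ^ n) (A n) sequentially"
    by (simp add: limitin_componentwise)
  \<comment> \<open>The singleton \<open>{A n}\<close> is open in the discrete topology, so the
    components eventually equal \<open>A n\<close>.\<close>
  then have "A n \<in> {0..<int p ^ n}"
    and "\<forall>\<^sub>F N in sequentially. (\<Sum>i<N. d i * int p ^ i) mod int p ^ n \<in> {A n}"
    unfolding limitin_def by auto
  then obtain M where M: "\<And>N. N \<ge> M \<Longrightarrow> (\<Sum>i<N. d i * int p ^ i) mod int p ^ n = A n"
    by (auto simp: eventually_sequentially)
  have "(\<Sum>i<n + k. d i * int p ^ i) mod int p ^ n = (\<Sum>i<n. d i * int p ^ i) mod int p ^ n" for k
  proof (induction k)
    case (Suc k)
    have "int p ^ n dvd d (n + k) * int p ^ (n + k)" by (simp add: le_imp_power_dvd)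
    then show ?case using Suc by (auto simp: mod_add_right_eq elim!: dvdE)
  qed simp
  from this[of M] M[of "n + M"] show ?thesis by simp
qed

section \<open>Carries between two digit sequences\<close>

lemma carry_sequence:
  assumes "p > (0::int)"
    and "\<And>t. [\<Sum>i<t. b i * p ^ i = \<Sum>i<t. a i * p ^ i] (mod p ^ t)"
  obtains e :: "nat \<Rightarrow> int"
  where "e 0 = 0" and "\<And>t. p * e (Suc t) = e t + b t - a t"
proof -
  have "\<exists>k. (\<Sum>i<t. b i * p ^ i) - (\<Sum>i<t. a i * p ^ i) = p ^ t * k" for t
    using assms(2)[of t] by (auto simp: cong_iff_dvd_diff elim: dvdE)
  then obtain e where e: "\<And>t. (\<Sum>i<t. b i * p ^ i) - (\<Sum>i<t. a i * p ^ i) = p ^ t * e t"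
    by metis
  have "e 0 = 0" using e[of 0] by simp
  moreover have "p * e (Suc t) = e t + b t - a t" for t
  proof -
    have "p ^ t * (p * e (Suc t)) = p ^ t * (e t + b t - a t)"
      using e[of t] e[of "Suc t"] by (simp add: algebra_simps)
    then show ?thesis using assms(1) by simp
  qed
  ultimately show ?thesis by (rule that)
qed

section \<open>Correction terms evaluated by Fermat's little theorem\<close>

lemma power_prime_minus_one_cong:
  assumes "prime p"
  shows "[x ^ (p - 1) = (if int p dvd x then 0 else 1)] (mod int p)"
proof (cases "int p dvd x")
  case True
  \<comment> \<open>A zero exponent would give 1 even for \<open>x\<close> divisible by
    \<open>p\<close>.\<close>
  have "p - 1 > 0" using prime_gt_1_nat[OF assms] by simp
  then have "int p dvd x ^ (p - 1)" using True by (simp add: dvd_power_same dvd_trans dvd_power)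
  then show ?thesis using True by (simp add: cong_0_iff)
next
  case False
  have p: "int p > 0" using prime_gt_0_nat[OF assms] by simp
  then have m: "int (nat (x mod int p)) = x mod int p" by simp
  then have "\<not> p dvd nat (x mod int p)" using False
    by (metis dvd_mod_iff dvd_refl int_dvd_int_iff)
  then have "[nat (x mod int p) ^ (p - 1) = 1] (mod p)" by (rule fermat_theorem[OF assms])
  then have "[(x mod int p) ^ (p - 1) = 1] (mod int p)"
    using m by (metis cong_int_iff of_nat_1 of_nat_power)
  then show ?thesis using False by (simp add: cong_def power_mod)
qed

text \<open>The new summand \<open>l = t\<close> carries an empty product, while each earlier
  summand gains the factor with index \<open>t\<close>.\<close>

lemma f_corr_Suc:
  "f_corr p (Suc t) x = (\<Sum>c = 1..(p - 1) div 2. (x t + int c) ^ (p - 1) - 1)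
     + f_corr p t x * (1 - x t ^ (p - 1))"
proof -
  have "{l<..<Suc t} = insert t {l<..<t}" if "l < t" for l using that by auto
  then show ?thesis
    unfolding f_corr_def by (simp add: sum_distrib_left sum_distrib_right mult_ac)
qed

lemma g_corr_Suc:
  "g_corr p (Suc t) y = (\<Sum>c = (p + 1) div 2..p - 1. 1 - (y t - int c) ^ (p - 1))
     + g_corr p t y * (1 - (y t - int ((p - 1) div 2)) ^ (p - 1))"
proof -
  have "{l<..<Suc t} = insert t {l<..<t}" if "l < t" for l using that by auto
  then show ?thesis
    unfolding g_corr_def by (simp add: sum_distrib_left sum_distrib_right mult_ac)
qed

text \<open>With \<open>p = 2 * h + 1\<close>, each \<open>x t + c\<close> has absolute value below
  \<open>p\<close>, so it is divisible by \<open>p\<close> only if \<open>c = - x t\<close>. One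
  \<open>c\<close> in \<open>1..h\<close> does this if \<open>x t < 0\<close>, and none otherwise;
  it contributes -1. The factor \<open>1 - x t ^ (p - 1)\<close> keeps the old value only at
  \<open>x t = 0\<close>.\<close>

lemma f_corr_Suc_cong:
  assumes "prime p" and "odd p" and "x t \<in> {- int ((p - 1) div 2)..int ((p - 1) div 2)}"
  shows "[f_corr p (Suc t) x = (if x t < 0 then - 1 else if x t = 0 then f_corr p t x else 0)]
           (mod int p)"
proof -
  obtain h where h: "p = 2 * h + 1" using assms(2) by (elim oddE)
  then have x: "- int h \<le> x t" "x t \<le> int h" using assms(3) by auto
  have dvd: "int p dvd z \<longleftrightarrow> z = 0" if "\<bar>z\<bar> < int p" for z
    using that dvd_imp_le_int[of z "int p"] by auto
  have "[(\<Sum>c = 1..h. (x t + int c) ^ (p - 1) - 1)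
      = (\<Sum>c = 1..h. (if int p dvd x t + int c then 0 else 1) - 1)] (mod int p)"
    by (intro cong_sum cong_diff power_prime_minus_one_cong[OF assms(1)] cong_refl)
  \<comment> \<open>For \<open>x t \<ge> 0\<close> the index \<open>nat (- x t)\<close> is 0, just
    outside the range of summation.\<close>
  also have "(\<Sum>c = 1..h. (if int p dvd x t + int c then 0 else 1) - 1)
      = (\<Sum>c = 1..h. if c = nat (- x t) then - 1 else (0::int))"
  proof (rule sum.cong)
    fix c assume "c \<in> {1..h}"
    then show "(if int p dvd x t + int c then 0 else 1) - 1
        = (if c = nat (- x t) then - 1 else (0::int))"
      using x h by (subst dvd) auto
  qed simp
  also have "\<dots> = (if x t < 0 then - 1 else 0)" using x by auto
  finally have *: "[(\<Sum>c = 1..h. (x t + int c) ^ (p - 1) - 1) = (if x t < 0 then - 1 else 0)]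
    (mod int p)" .
  have "[1 - x t ^ (p - 1) = 1 - (if int p dvd x t then 0 else 1)] (mod int p)"
    by (intro cong_diff power_prime_minus_one_cong[OF assms(1)] cong_refl)
  also have "1 - (if int p dvd x t then 0 else 1) = (if x t = 0 then 1 else (0::int))"
    using x h by (subst dvd) auto
  finally have "[f_corr p (Suc t) x
      = (if x t < 0 then - 1 else 0) + f_corr p t x * (if x t = 0 then 1 else 0)] (mod int p)"
    unfolding f_corr_Suc using * h by (intro cong_add cong_mult cong_refl) simp_all
  then show ?thesis by (simp split: if_splits)
qed

text \<open>Here \<open>y t - c\<close> vanishes for one \<open>c\<close> in
  \<open>h + 1..2 * h\<close> exactly when \<open>y t > h\<close>, and the factor with index
  \<open>t\<close> singles out the middle digit \<open>y t = h\<close>.\<close>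

lemma g_corr_Suc_cong:
  assumes "prime p" and "odd p" and "y t \<in> {0..int p - 1}"
  shows "[g_corr p (Suc t) y = (if y t > int ((p - 1) div 2) then 1
           else if y t = int ((p - 1) div 2) then g_corr p t y else 0)] (mod int p)"
proof -
  obtain h where h: "p = 2 * h + 1" using assms(2) by (elim oddE)
  then have h': "(p - 1) div 2 = h" "(p + 1) div 2 = h + 1" "p - 1 = 2 * h" by auto
  have y: "0 \<le> y t" "y t \<le> 2 * int h" using assms(3) h by auto
  have dvd: "int p dvd z \<longleftrightarrow> z = 0" if "\<bar>z\<bar> < int p" for z
    using that dvd_imp_le_int[of z "int p"] by auto
  have "[(\<Sum>c = h + 1..2 * h. 1 - (y t - int c) ^ (p - 1))
      = (\<Sum>c = h + 1..2 * h. 1 - (if int p dvd y t - int c then 0 else 1))] (mod int p)"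
    by (intro cong_sum cong_diff power_prime_minus_one_cong[OF assms(1)] cong_refl)
  also have "(\<Sum>c = h + 1..2 * h. 1 - (if int p dvd y t - int c then 0 else 1))
      = (\<Sum>c = h + 1..2 * h. if c = nat (y t) then 1 else (0::int))"
  proof (rule sum.cong)
    fix c assume "c \<in> {h + 1..2 * h}"
    then show "1 - (if int p dvd y t - int c then 0 else 1)
        = (if c = nat (y t) then 1 else (0::int))"
      using y h by (subst dvd) auto
  qed simp
  also have "\<dots> = (if y t > int h then 1 else 0)" using y by auto
  finally have *: "[(\<Sum>c = h + 1..2 * h. 1 - (y t - int c) ^ (p - 1))
      = (if y t > int h then 1 else 0)] (mod int p)" .
  have "[1 - (y t - int h) ^ (p - 1) = 1 - (if int p dvd y t - int h then 0 else 1)] (mod int p)"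
    by (intro cong_diff power_prime_minus_one_cong[OF assms(1)] cong_refl)
  also have "1 - (if int p dvd y t - int h then 0 else 1) = (if y t = int h then 1 else (0::int))"
    using y h by (subst dvd) auto
  finally have "[g_corr p (Suc t) y
      = (if y t > int h then 1 else 0) + g_corr p t y * (if y t = int h then 1 else 0)] (mod int p)"
    unfolding g_corr_Suc using * h' by (intro cong_add cong_mult cong_refl) simp_all
  then show ?thesis unfolding h' by (simp split: if_splits)
qed

section \<open>Determination of the carries and conclusion\<close>

text \<open>Once \<open>e'\<close> is 0 or 1, the wrong value pushes the other digit out of its
  range. In the boundary cases \<open>a = 0\<close> and \<open>b = h\<close>, the range of the other
  digit forces \<open>e' = e\<close>.\<close>

lemma carry_step:
  fixes h e e' a b :: int
  assumes "(2 * h + 1) * e' = e + b - a" and "h > 0" and "e \<in> {0, 1}"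
    and "a \<in> {- h..h}" and "b \<in> {0..2 * h}"
  shows "e' = (if a < 0 then 1 else if a = 0 then e else 0)"
    and "e' = (if b > h then 1 else if b = h then e else 0)"
proof -
  \<comment> \<open>The quantity \<open>e + b - a\<close> lies between \<open>- h\<close> and
    \<open>3 * h + 1\<close>.\<close>
  have "(2 * h + 1) * - 1 < (2 * h + 1) * e'" "(2 * h + 1) * e' < (2 * h + 1) * 2"
    using assms by auto
  moreover have "2 * h + 1 > 0" using assms(2) by simp
  ultimately have "- 1 < e'" "e' < 2" by (simp_all only: mult_less_cancel_left_pos)
  then have "e' = 0 \<or> e' = 1" by linarith
  then show "e' = (if a < 0 then 1 else if a = 0 then e else 0)"
    and "e' = (if b > h then 1 else if b = h then e else 0)"
    using assms by auto
qed

theorem theorem5p1: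
  fixes p :: nat and A :: "nat \<Rightarrow> int" and a b :: "nat \<Rightarrow> int"
  assumes "prime p" and "p \<ge> 3"
    and "A \<in> carrier (padic_int p)"
    and "padic_expansion p a A" and "padic_expansion p b A"
    and "\<And>i. a i \<in> {- int ((p - 1) div 2)..int ((p - 1) div 2)}"
    and "\<And>j. b j \<in> {0..int p - 1}"
  shows "\<forall>t. [b t = a t + f_corr p t a] (mod int p) \<and> [a t = b t + g_corr p t b] (mod int p)"
proof -
  have odd: "odd p" using assms(1,2) by (simp add: prime_odd_nat)
  define h where "h = int ((p - 1) div 2)"
  have h: "int p = 2 * h + 1" "h > 0" using odd assms(2) by (auto simp: h_def elim!: oddE)
  have p0: "p > 0" using assms(2) by simp
  obtain e where e0: "e 0 = 0" and e: "\<And>t. int p * e (Suc t) = e t + b t - a t"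
  proof (rule carry_sequence[of "int p" b a])
    show "[\<Sum>i<t. b i * int p ^ i = \<Sum>i<t. a i * int p ^ i] (mod int p ^ t)" for t
      using padic_expansion_truncation[OF p0 assms(4), of t]
        padic_expansion_truncation[OF p0 assms(5), of t]
      by (simp add: cong_def)
  qed (use p0 in auto)
  have a: "a t \<in> {- h..h}" and b: "b t \<in> {0..2 * h}" for t
    using assms(6)[of t] assms(7)[of t] h(1) by (auto simp: h_def)
  have step: "e (Suc t) = (if a t < 0 then 1 else if a t = 0 then e t else 0)"
    "e (Suc t) = (if b t > h then 1 else if b t = h then e t else 0)"
    if "e t \<in> {0, 1}" for t
    using carry_step[OF e[of t, unfolded h(1)] h(2) that a b] by blast+
  \<comment> \<open>The range of \<open>e t\<close> is part of the invariant because both carry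
    rules depend on it.\<close>
  have inv: "e t \<in> {0, 1} \<and> [f_corr p t a = - e t] (mod int p) \<and> [g_corr p t b = e t] (mod int p)"
    for t
  proof (induction t)
    case 0
    show ?case by (simp add: e0 f_corr_def g_corr_def)
  next
    case (Suc t)
    then have et: "e t \<in> {0, 1}" by simp
    have "[f_corr p (Suc t) a = (if a t < 0 then - 1 else if a t = 0 then f_corr p t a else 0)]
        (mod int p)"
      by (rule f_corr_Suc_cong) (use assms odd in auto)
    \<comment> \<open>The cases match those of the carry up to sign; at \<open>a t = 0\<close> the
      induction hypothesis replaces \<open>f_corr p t a\<close> by \<open>- e t\<close>.\<close>
    also have "[(if a t < 0 then - 1 else if a t = 0 then f_corr p t a else 0) = - e (Suc t)]
        (mod int p)"
      using Suc unfolding step(1)[OF et] by simp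
    finally have f: "[f_corr p (Suc t) a = - e (Suc t)] (mod int p)" .
    have "[g_corr p (Suc t) b = (if b t > h then 1 else if b t = h then g_corr p t b else 0)]
        (mod int p)"
      unfolding h_def by (rule g_corr_Suc_cong) (use assms odd in auto)
    also have "[(if b t > h then 1 else if b t = h then g_corr p t b else 0) = e (Suc t)]
        (mod int p)"
      using Suc unfolding step(2)[OF et] by simp
    finally have g: "[g_corr p (Suc t) b = e (Suc t)] (mod int p)" .
    show ?case using f g et step(1)[OF et] by auto
  qed
  show ?thesis
  proof (intro allI conjI)
    fix t
    \<comment> \<open>The carry recursion read modulo \<open>p\<close>: the differences of the two
      sides are \<open>p * e (Suc t)\<close> and its negative.\<close>
    have "[b t = a t + - e t] (mod int p)" "[a t = b t + e t] (mod int p)"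
      using e[of t]
      by (auto simp: cong_iff_dvd_diff algebra_simps dvd_def
          intro: exI[of _ "- e (Suc t)"] exI[of _ "e (Suc t)"])
    moreover have "[a t + f_corr p t a = a t + - e t] (mod int p)"
      "[b t + g_corr p t b = b t + e t] (mod int p)"
      by (intro cong_add cong_refl; use inv[of t] in blast)+
    ultimately show "[b t = a t + f_corr p t a] (mod int p)" "[a t = b t + g_corr p t b] (mod int p)"
      by (meson cong_sym cong_trans)+
  qed
qed

end
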